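(* Let $(U,\mathscr{B})$, $\Gamma$, $\Gamma^*$, $S\subseteq\mathbb{R}^r$, $A,B:S\times U\to\mathbb{R}$, $I_\alpha(\Psi)$ and $C(\alpha,u)$ be as described in the context. Assume: (i) the integrals $\int_U A(\alpha,u)\,d\Psi(u)$ and $\int_U B(\alpha,u)\,d\Psi(u)$ exist for all $\Psi\in\Gamma$, $\alpha\in S$; (ii) $\Gamma^*\subset\Gamma$ (every degenerate probability measure belongs to $\Gamma$); (iii) $B$ is strictly of constant sign: either $B(\alpha,u)>0$ for all $(\alpha,u)\in S\times U$, or $B(\alpha,u)<0$ for all $(\alpha,u)\in S\times U$. Assume that the test function $C(\alpha,u)=A(\alpha,u)/B(\alpha,u)$ is not bounded above (respectively, not bounded below) on $S\times U$. Then the linear-fractional integral functional $(\alpha,\Psi)\mapsto I_\alpha(\Psi)$ is also not bounded above (respectively, not bounded below) on $S\times\Gamma$, and the following assertions hold. 1. If $C$ is not bounded above, there exists a sequence $\left(\alpha^{(+)}_n,\Psi^{*(+)}_n\right)$, $\alpha^{(+)}_n\in S$, $\Psi^{*(+)}_n\in\Gamma^*$, $n=1,2,\dots$, such that $I_{\alpha^{(+)}_n}\left(\Psi^{*(+)}_n\right)\to\infty$ as $n\to\infty$. 2. If $C$ is not bounded below, there exists a sequence $\left(\alpha^{(-)}_n,\Psi^{*(-)}_n\right)$, $\alpha^{(-)}_n\in S$, $\Psi^{*(-)}_n\in\Gamma^*$, $n=1,2,\dots$, such that $I_{\alpha^{(-)}_n}\left(\Psi^{*(-)}_n\right)\to-\infty$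 as $n\to\infty$.
   Context: $(U,\mathscr{B})$ is a measurable space: $U$ is an arbitrary set and $\mathscr{B}$ is a $\sigma$-algebra of subsets of $U$ containing all singletons. $\Gamma$ is a set of probability measures on $\mathscr{B}$. A probability measure $\Psi^*$ on $\mathscr{B}$ is called degenerate if there is a point $u^*\in U$ (the concentration point) such that $\Psi^*(\{u^*\})=1$ and $\Psi^*(B^* )=0$ for every $B^*\in\mathscr{B}$ not containing $u^*$; it is then denoted $\Psi^*_{u^*}$. $\Gamma^*$ is the set of all degenerate probability measures on $(U,\mathscr{B})$. $S\subseteq\mathbb{R}^r$ is a set of values of a vector parameter $\alpha$. $A,B:S\times U\to\mathbb{R}$ are measurable functions. For $\alpha\in S$, $\Psi\in\Gamma$ put $$I_\alpha(\Psi)=\frac{\int_U A(\alpha,u)\,d\Psi(u)}{\int_U B(\alpha,u)\,d\Psi(u)},$$ where the integrals are Lebesgue integrals with respect to $\Psi$ and "exist" means they exist with finite real values. The test function is $C(\alpha,u)=A(\alpha,u)/B(\alpha,u)$, $(\alpha,u)\in S\times U$. *)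

theory Defs
  imports "HOL-Probability.Probability"
begin

text \<open>
  A measurable space \<open>(U, \<B>)\<close> is represented by a measure \<open>M\<close> of which only
  \<open>U = space M\<close> and \<open>\<B> = sets M\<close> are used; the probability measures on \<open>\<B>\<close> are the
  \<open>\<Psi>\<close> with \<open>prob_space \<Psi>\<close> and \<open>sets \<Psi> = sets M\<close>.
\<close>

definition degenerate_at :: "'u measure \<Rightarrow> 'u \<Rightarrow> 'u measure \<Rightarrow> bool" where
  "degenerate_at M u \<Psi> \<longleftrightarrow>
     prob_space \<Psi> \<and> sets \<Psi> = sets M \<and> u \<in> space M \<and>
     measure \<Psi> {u} = 1 \<and> (\<forall>E\<in>sets M. u \<notin> E \<longrightarrow> measure \<Psi> E = 0)"

definition degenerate_measures :: "'u measure \<Rightarrow> 'u measure set" where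
  "degenerate_measures M = {\<Psi>. \<exists>u. degenerate_at M u \<Psi>}"

definition linfrac_functional ::
    "('a \<Rightarrow> 'u \<Rightarrow> real) \<Rightarrow> ('a \<Rightarrow> 'u \<Rightarrow> real) \<Rightarrow> 'a \<Rightarrow> 'u measure \<Rightarrow> real" where
  "linfrac_functional A B \<alpha> \<Psi> = (LINT u|\<Psi>. A \<alpha> u) / (LINT u|\<Psi>. B \<alpha> u)"

definition test_function ::
    "('a \<Rightarrow> 'u \<Rightarrow> real) \<Rightarrow> ('a \<Rightarrow> 'u \<Rightarrow> real) \<Rightarrow> 'a \<Rightarrow> 'u \<Rightarrow> real" where
  "test_function A B \<alpha> u = A \<alpha> u / B \<alpha> u"

end

theory Submission
  imports Defs
begin

text \<open>
  On the point mass at \<open>u\<close>, integration is evaluation at \<open>u\<close>, so the linear-fractional functional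
  there takes the value \<open>A \<alpha> u / B \<alpha> u\<close> of the test function
  (\<open>linfrac_functional_return\<close>). Hence every value of the test function on \<open>S \<times> space M\<close> is a value
  of the functional on \<open>S \<times> \<Gamma>\<close>, and the functional is unbounded in every direction in which the test
  function is. An unbounded set of reals contains a sequence diverging to infinity; choosing such a
  sequence among the values of the test function and replacing its points by their point masses
  gives the sequences asked for.
\<close>

lemma degenerate_at_return:
  assumes "u \<in> space M" "{u} \<in> sets M"
  shows "degenerate_at M u (return M u)"
  using assms by (auto simp: degenerate_at_def prob_space_return measure_return)

text \<open>
  Measurability is needed because the Bochner integral of a function that is not measurable is zero
  by convention, whatever its value at \<open>u\<close>.
\<close>

lemma linfrac_functional_return:
  assumes "u \<in> space M" "A \<alpha> \<in> borel_measurable M" "B \<alpha> \<in> borel_measurable M"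
  shows "linfrac_functional A B \<alpha> (return M u) = test_function A B \<alpha> u"
  using assms by (simp add: linfrac_functional_def test_function_def integral_return)

lemma unbounded_above_imp_sequence_at_top:
  fixes f :: "'a \<Rightarrow> real"
  assumes "\<not> bdd_above (f ` X)"
  obtains x :: "nat \<Rightarrow> 'a" where "\<And>n. x n \<in> X" "filterlim (\<lambda>n. f (x n)) at_top sequentially"
proof -
  have "\<exists>x\<in>X. real n \<le> f x" for n
    using assms by (force simp: bdd_above_def not_le dest: spec[of _ "real n"] intro: less_imp_le)
  then obtain x where x: "\<And>n. x n \<in> X" "\<And>n. real n \<le> f (x n)"
    by metis
  have "filterlim (\<lambda>n. f (x n)) at_top sequentially"
    using filterlim_real_sequentially by (rule filterlim_at_top_mono) (simp add: x(2))
  with x(1) show thesis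
    by (rule that)
qed

lemma unbounded_below_imp_sequence_at_bot:
  fixes f :: "'a \<Rightarrow> real"
  assumes "\<not> bdd_below (f ` X)"
  obtains x :: "nat \<Rightarrow> 'a" where "\<And>n. x n \<in> X" "filterlim (\<lambda>n. f (x n)) at_bot sequentially"
proof -
  have "\<not> bdd_above ((\<lambda>x. - f x) ` X)"
    using assms by (simp add: bdd_above_uminus[of "f ` X", symmetric] image_image)
  then obtain x where "\<And>n. x n \<in> X" "filterlim (\<lambda>n. - f (x n)) at_top sequentially"
    by (rule unbounded_above_imp_sequence_at_top) blast
  then show thesis
    by (intro that) (auto simp: filterlim_uminus_at_bot)
qed

theorem theorem3:
  fixes M :: "'u measure"
    and \<Gamma> :: "'u measure set"
    and S :: "(real ^ 'r) set"
    and A B :: "real ^ 'r \<Rightarrow> 'u \<Rightarrow> real"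
  assumes singletons: "\<And>u. u \<in> space M \<Longrightarrow> {u} \<in> sets M"
    and \<Gamma>_prob: "\<And>\<Psi>. \<Psi> \<in> \<Gamma> \<Longrightarrow> prob_space \<Psi> \<and> sets \<Psi> = sets M"
    and A_meas: "(\<lambda>(\<alpha>, u). A \<alpha> u) \<in> borel_measurable (restrict_space borel S \<Otimes>\<^sub>M M)"
    and B_meas: "(\<lambda>(\<alpha>, u). B \<alpha> u) \<in> borel_measurable (restrict_space borel S \<Otimes>\<^sub>M M)"
    and A_int: "\<And>\<alpha> \<Psi>. \<alpha> \<in> S \<Longrightarrow> \<Psi> \<in> \<Gamma> \<Longrightarrow> integrable \<Psi> (A \<alpha>)"
    and B_int: "\<And>\<alpha> \<Psi>. \<alpha> \<in> S \<Longrightarrow> \<Psi> \<in> \<Gamma> \<Longrightarrow> integrable \<Psi> (B \<alpha>)"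
    and degenerate: "degenerate_measures M \<subseteq> \<Gamma>"
    and B_sign: "(\<forall>\<alpha>\<in>S. \<forall>u\<in>space M. B \<alpha> u > 0) \<or> (\<forall>\<alpha>\<in>S. \<forall>u\<in>space M. B \<alpha> u < 0)"
  shows "(\<not> bdd_above ((\<lambda>(\<alpha>, u). test_function A B \<alpha> u) ` (S \<times> space M)) \<longrightarrow>
            \<not> bdd_above ((\<lambda>(\<alpha>, \<Psi>). linfrac_functional A B \<alpha> \<Psi>) ` (S \<times> \<Gamma>)) \<and>
            (\<exists>(\<alpha>s :: nat \<Rightarrow> real ^ 'r) (\<Psi>s :: nat \<Rightarrow> 'u measure).
               (\<forall>n. \<alpha>s n \<in> S \<and> \<Psi>s n \<in> degenerate_measures M) \<and>
               filterlim (\<lambda>n. linfrac_functional A B (\<alpha>s n) (\<Psi>s n)) at_top sequentially)) \<and>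
         (\<not> bdd_below ((\<lambda>(\<alpha>, u). test_function A B \<alpha> u) ` (S \<times> space M)) \<longrightarrow>
            \<not> bdd_below ((\<lambda>(\<alpha>, \<Psi>). linfrac_functional A B \<alpha> \<Psi>) ` (S \<times> \<Gamma>)) \<and>
            (\<exists>(\<alpha>s :: nat \<Rightarrow> real ^ 'r) (\<Psi>s :: nat \<Rightarrow> 'u measure).
               (\<forall>n. \<alpha>s n \<in> S \<and> \<Psi>s n \<in> degenerate_measures M) \<and>
               filterlim (\<lambda>n. linfrac_functional A B (\<alpha>s n) (\<Psi>s n)) at_bot sequentially))"
proof -
  let ?T = "\<lambda>(\<alpha>, u). test_function A B \<alpha> u"
  let ?I = "\<lambda>(\<alpha>, \<Psi>). linfrac_functional A B \<alpha> \<Psi>"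
  have ret: "return M u \<in> degenerate_measures M" if "u \<in> space M" for u
    using degenerate_at_return[OF that singletons[OF that]] by (auto simp: degenerate_measures_def)
  \<comment> \<open>Integrability against a single point mass already contains measurability of the section.\<close>
  have at_return: "linfrac_functional A B \<alpha> (return M u) = test_function A B \<alpha> u"
    if "\<alpha> \<in> S" "u \<in> space M" for \<alpha> u
  proof (rule linfrac_functional_return)
    have "return M u \<in> \<Gamma>"
      using ret[OF that(2)] degenerate by auto
    then show "A \<alpha> \<in> borel_measurable M" "B \<alpha> \<in> borel_measurable M"
      using borel_measurable_integrable[OF A_int[OF that(1)]]
        borel_measurable_integrable[OF B_int[OF that(1)]] by force+
  qed fact
  have values_subset: "?T ` (S \<times> space M) \<subseteq> ?I ` (S \<times> \<Gamma>)"
  proof clarify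
    fix \<alpha> u
    assume "\<alpha> \<in> S" "u \<in> space M"
    then show "test_function A B \<alpha> u \<in> ?I ` (S \<times> \<Gamma>)"
      using ret degenerate by (intro image_eqI[of _ _ "(\<alpha>, return M u)"]) (auto simp: at_return)
  qed
  have transfer: "\<exists>\<alpha>s \<Psi>s. (\<forall>n. \<alpha>s n \<in> S \<and> \<Psi>s n \<in> degenerate_measures M) \<and>
      filterlim (\<lambda>n. linfrac_functional A B (\<alpha>s n) (\<Psi>s n)) F sequentially"
    if p: "\<And>n. p n \<in> S \<times> space M" and lim: "filterlim (\<lambda>n. ?T (p n)) F sequentially"
    for p :: "nat \<Rightarrow> (real ^ 'r) \<times> 'u" and F
  proof (intro exI conjI allI)
    have p': "fst (p n) \<in> S" "snd (p n) \<in> space M" for n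
      using p[of n] by auto
    then show "fst (p n) \<in> S" "return M (snd (p n)) \<in> degenerate_measures M" for n
      by (auto intro: ret)
    show "filterlim (\<lambda>n. linfrac_functional A B (fst (p n)) (return M (snd (p n)))) F sequentially"
      using lim by (simp add: at_return p' case_prod_beta)
  qed
  show ?thesis
  proof (intro conjI impI)
    assume unbounded: "\<not> bdd_above (?T ` (S \<times> space M))"
    then show "\<not> bdd_above (?I ` (S \<times> \<Gamma>))"
      using bdd_above_mono[OF _ values_subset] by auto
    from unbounded show "\<exists>\<alpha>s \<Psi>s. (\<forall>n. \<alpha>s n \<in> S \<and> \<Psi>s n \<in> degenerate_measures M) \<and>
        filterlim (\<lambda>n. linfrac_functional A B (\<alpha>s n) (\<Psi>s n)) at_top sequentially"
      by (rule unbounded_above_imp_sequence_at_top) (rule transfer)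
  next
    assume unbounded: "\<not> bdd_below (?T ` (S \<times> space M))"
    then show "\<not> bdd_below (?I ` (S \<times> \<Gamma>))"
      using bdd_below_mono[OF _ values_subset] by auto
    from unbounded show "\<exists>\<alpha>s \<Psi>s. (\<forall>n. \<alpha>s n \<in> S \<and> \<Psi>s n \<in> degenerate_measures M) \<and>
        filterlim (\<lambda>n. linfrac_functional A B (\<alpha>s n) (\<Psi>s n)) at_bot sequentially"
      by (rule unbounded_below_imp_sequence_at_bot) (rule transfer)
  qed
qed

end
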